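(* Let $(E,sim,ser,inl)$ be a g-comtrace alphabet. For every g-comtrace $\mathbf{u}\in\mathbb{S}^*/\!\equiv$ there exists a step sequence $u\in\mathbf{u}$ that is maximally concurrent.
   Context: A g-comtrace alphabet is $(E,sim,ser,inl)$ with $E$ finite, $sim,inl\subseteq E\times E$ irreflexive and symmetric, $ser\subseteq sim$, $sim\cap inl=\emptyset$. Steps $\mathbb{S}$: nonempty $A\subseteq E$ with $(a,b)\in sim$ for all distinct $a,b\in A$. The g-comtrace congruence $\equiv$ on $\mathbb{S}^*$ is the reflexive symmetric transitive closure of pairs $(wAz,wBCz)$ ($A,B,C\in\mathbb{S}$, $A=B\cup C$, $B\times C\subseteq ser$) and $(wABz,wBAz)$ ($A,B\in\mathbb{S}$, $A\times B\subseteq inl$); g-comtraces are its equivalence classes. For $x=A_1\dots A_k$, $\mathrm{length}(x)=k$; $A_i$ is maximally concurrent in $x$ iff for all $B\in\mathbb{S},y\in\mathbb{S}^*$, $By\equiv A_i\dots A_k\Rightarrow|B|\le|A_i|$; $mc(x)$ is the smallest $i$ such that $A_i$ is maximally concurrent in $x$. A step sequence $u=A_1\dots A_k$ is maximally concurrent iff (1) $v\equiv u\Rightarrow\mathrm{length}(u)\le\mathrm{length}(v)$ for all $v$, and (2) for all $i=1,\dots,k$ and all $w$, with $u_i=A_i\dots A_k$: $(u_i\equiv w\wedge\mathrm{length}(u_i)=\mathrm{length}(w))\Rightarrow mc(u_i)\le mc(w)$. *)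

theory Defs
  imports Main
begin

locale g_comtrace_alphabet =
  fixes E :: "'a set" and sim ser inl :: "'a rel"
  assumes finite_E: "finite E"
    and sim_subset: "sim \<subseteq> E \<times> E"
    and irrefl_sim: "irrefl sim"
    and sym_sim: "sym sim"
    and inl_subset: "inl \<subseteq> E \<times> E"
    and irrefl_inl: "irrefl inl"
    and sym_inl: "sym inl"
    and ser_subset: "ser \<subseteq> sim"
    and sim_inl_disjoint: "sim \<inter> inl = {}"

definition steps :: "'a set \<Rightarrow> 'a rel \<Rightarrow> 'a set set" where
  "steps E sim = {A. A \<noteq> {} \<and> A \<subseteq> E \<and> (\<forall>a\<in>A. \<forall>b\<in>A. a \<noteq> b \<longrightarrow> (a, b) \<in> sim)}"

abbreviation step_seqs :: "'a set \<Rightarrow> 'a rel \<Rightarrow> 'a set list set" where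
  "step_seqs E sim \<equiv> lists (steps E sim)"

inductive_set gct_rewrite :: "'a set \<Rightarrow> 'a rel \<Rightarrow> 'a rel \<Rightarrow> 'a rel \<Rightarrow> 'a set list rel"
  for E :: "'a set" and sim ser inl :: "'a rel"
where
  split:
    "\<lbrakk> w \<in> step_seqs E sim; z \<in> step_seqs E sim;
       A \<in> steps E sim; B \<in> steps E sim; C \<in> steps E sim; A = B \<union> C; B \<times> C \<subseteq> ser \<rbrakk>
     \<Longrightarrow> (w @ [A] @ z, w @ [B, C] @ z) \<in> gct_rewrite E sim ser inl"
| swap:
    "\<lbrakk> w \<in> step_seqs E sim; z \<in> step_seqs E sim;
       A \<in> steps E sim; B \<in> steps E sim; A \<times> B \<subseteq> inl \<rbrakk>
     \<Longrightarrow> (w @ [A, B] @ z, w @ [B, A] @ z) \<in> gct_rewrite E sim ser inl"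

text \<open>The reflexive closure ranges over all lists of sets, so the result is restricted to
  step sequences.\<close>

definition gct_cong :: "'a set \<Rightarrow> 'a rel \<Rightarrow> 'a rel \<Rightarrow> 'a rel \<Rightarrow> 'a set list rel" where
  "gct_cong E sim ser inl =
     (gct_rewrite E sim ser inl \<union> (gct_rewrite E sim ser inl)\<inverse>)\<^sup>*
     \<inter> (step_seqs E sim \<times> step_seqs E sim)"

definition g_comtraces :: "'a set \<Rightarrow> 'a rel \<Rightarrow> 'a rel \<Rightarrow> 'a rel \<Rightarrow> 'a set list set set" where
  "g_comtraces E sim ser inl = step_seqs E sim // gct_cong E sim ser inl"

text \<open>Positions are counted from 1: the step \<open>A\<^sub>i\<close> of \<open>x\<close> is \<open>x ! (i - 1)\<close>, and the suffix
  starting with it is \<open>drop (i - 1) x\<close>.\<close>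

definition max_concurrent_at ::
  "'a set \<Rightarrow> 'a rel \<Rightarrow> 'a rel \<Rightarrow> 'a rel \<Rightarrow> 'a set list \<Rightarrow> nat \<Rightarrow> bool" where
  "max_concurrent_at E sim ser inl x i \<longleftrightarrow>
     (\<forall>B \<in> steps E sim. \<forall>y \<in> step_seqs E sim.
        (B # y, drop (i - 1) x) \<in> gct_cong E sim ser inl \<longrightarrow> card B \<le> card (x ! (i - 1)))"

text \<open>Meaningful only for nonempty \<open>x\<close>. There the last step is always maximally concurrent,
  since rewriting preserves the number of occurrences of each event.\<close>

definition mc :: "'a set \<Rightarrow> 'a rel \<Rightarrow> 'a rel \<Rightarrow> 'a rel \<Rightarrow> 'a set list \<Rightarrow> nat" where
  "mc E sim ser inl x = (LEAST i. i \<in> {1..length x} \<and> max_concurrent_at E sim ser inl x i)"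

definition maximally_concurrent ::
  "'a set \<Rightarrow> 'a rel \<Rightarrow> 'a rel \<Rightarrow> 'a rel \<Rightarrow> 'a set list \<Rightarrow> bool" where
  "maximally_concurrent E sim ser inl u \<longleftrightarrow>
     u \<in> step_seqs E sim \<and>
     (\<forall>v. (v, u) \<in> gct_cong E sim ser inl \<longrightarrow> length u \<le> length v) \<and>
     (\<forall>i \<in> {1..length u}. \<forall>w.
        (drop (i - 1) u, w) \<in> gct_cong E sim ser inl \<and> length (drop (i - 1) u) = length w \<longrightarrow>
        mc E sim ser inl (drop (i - 1) u) \<le> mc E sim ser inl w)"

end

theory Submission
  imports Defs
begin

text \<open>Whether a step is maximally concurrent depends only on that step and on the class of the
  suffix it begins. So replacing the tail of a sequence by an equivalent one whose \<open>mc\<close> is not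
  larger does not increase the \<open>mc\<close> of the whole sequence. Among the shortest members of a class,
  take one with the least \<open>mc\<close> and replace its tail, by induction on the length, with an
  equivalent maximally concurrent sequence.\<close>

lemma gct_cong_step_seqs:
  assumes "(x, y) \<in> gct_cong E sim ser inl"
  shows "x \<in> step_seqs E sim" and "y \<in> step_seqs E sim"
  using assms by (auto simp: gct_cong_def)

lemma gct_cong_refl: "x \<in> step_seqs E sim \<Longrightarrow> (x, x) \<in> gct_cong E sim ser inl"
  by (simp add: gct_cong_def)

lemma sym_gct_cong: "sym (gct_cong E sim ser inl)"
  unfolding gct_cong_def
  by (intro sym_Int sym_rtrancl sym_Un_converse) (auto simp: sym_def)

lemmas gct_cong_sym = symD[OF sym_gct_cong]

lemma trans_gct_cong: "trans (gct_cong E sim ser inl)"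
  unfolding gct_cong_def by (intro trans_Int trans_rtrancl) (auto simp: trans_def)

lemmas gct_cong_trans = transD[OF trans_gct_cong]

lemma gct_rewrite_Cons:
  assumes "(x, y) \<in> gct_rewrite E sim ser inl" and "A \<in> steps E sim"
  shows "(A # x, A # y) \<in> gct_rewrite E sim ser inl"
  using assms(1)
proof cases
  case (split w z A' B C)
  then show ?thesis
    using gct_rewrite.split[of "A # w" E sim z A' B C ser inl] assms(2) by simp
next
  case (swap w z A' B)
  then show ?thesis
    using gct_rewrite.swap[of "A # w" E sim z A' B inl ser] assms(2) by simp
qed

lemma gct_cong_Cons:
  assumes "(x, y) \<in> gct_cong E sim ser inl" and "A \<in> steps E sim"
  shows "(A # x, A # y) \<in> gct_cong E sim ser inl"
proof -
  let ?R = "gct_rewrite E sim ser inl \<union> (gct_rewrite E sim ser inl)\<inverse>"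
  have "(x, y) \<in> ?R\<^sup>*"
    using assms(1) by (simp add: gct_cong_def)
  then have "(A # x, A # y) \<in> ?R\<^sup>*"
  proof induction
    case (step y z)
    then have "(A # y, A # z) \<in> ?R"
      using gct_rewrite_Cons[OF _ assms(2)] by auto
    with step.IH show ?case by (rule rtrancl_into_rtrancl)
  qed simp
  then show ?thesis
    using assms by (simp add: gct_cong_def)
qed

lemma gct_rewrite_Union_eq:
  "(x, y) \<in> gct_rewrite E sim ser inl \<Longrightarrow> \<Union> (set x) = \<Union> (set y)"
  by (induction rule: gct_rewrite.induct) auto

text \<open>A coarse invariant suffices in place of event counts: it confines every step of a
  sequence equivalent to \<open>[A]\<close> to subsets of \<open>A\<close>.\<close>

lemma gct_cong_Union_eq:
  assumes "(x, y) \<in> gct_cong E sim ser inl"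
  shows "\<Union> (set x) = \<Union> (set y)"
proof -
  have "(x, y) \<in> (gct_rewrite E sim ser inl \<union> (gct_rewrite E sim ser inl)\<inverse>)\<^sup>*"
    using assms by (simp add: gct_cong_def)
  then show ?thesis
    by induction (auto dest!: gct_rewrite_Union_eq)
qed

text \<open>The suffix at the last position is a single step, so the invariant above bounds its
  competitors. Hence the \<open>LEAST\<close> in \<open>mc\<close> is attained for nonempty step
  sequences.\<close>

lemma max_concurrent_at_length:
  assumes "finite E" and "x \<in> step_seqs E sim" and "x \<noteq> []"
  shows "max_concurrent_at E sim ser inl x (length x)"
proof -
  obtain t A where x: "x = t @ [A]"
    using assms(3) by (cases x rule: rev_cases) auto
  then have "finite A"
    using assms(1,2) by (auto simp: steps_def intro: finite_subset)
  then show ?thesis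
    by (auto simp: max_concurrent_at_def x dest!: gct_cong_Union_eq intro: card_mono)
qed

text \<open>At \<open>i = 0\<close> truncated subtraction would compare the head \<open>A\<close>
  with the head of \<open>t\<close>, hence the guard.\<close>

lemma max_concurrent_at_Cons_Suc:
  "0 < i \<Longrightarrow>
    max_concurrent_at E sim ser inl (A # t) (Suc i) = max_concurrent_at E sim ser inl t i"
  by (cases i) (simp_all add: max_concurrent_at_def)

text \<open>Equivalent sequences have the same competitors, and here both heads are
  \<open>A\<close>.\<close>

lemma max_concurrent_at_1_cong:
  assumes "(A # s, A # t) \<in> gct_cong E sim ser inl"
  shows "max_concurrent_at E sim ser inl (A # s) 1 = max_concurrent_at E sim ser inl (A # t) 1"
proof -
  have "(x, A # s) \<in> gct_cong E sim ser inl \<longleftrightarrow> (x, A # t) \<in> gct_cong E sim ser inl" for x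
    using assms gct_cong_sym[OF assms] by (blast intro: gct_cong_trans)
  then show ?thesis
    by (simp add: max_concurrent_at_def)
qed

lemma mc_Cons:
  assumes "finite E" and "t \<in> step_seqs E sim" and "t \<noteq> []"
  shows "mc E sim ser inl (A # t) =
    (if max_concurrent_at E sim ser inl (A # t) 1 then 1 else Suc (mc E sim ser inl t))"
proof (cases "max_concurrent_at E sim ser inl (A # t) 1")
  case True
  then show ?thesis
    by (auto simp: mc_def intro!: Least_equality)
next
  case False
  let ?P = "\<lambda>i. i \<in> {1..length (A # t)} \<and> max_concurrent_at E sim ser inl (A # t) i"
  \<comment> \<open>The last position is the witness that \<open>Least_Suc\<close> requires.\<close>
  have "?P (Suc (length t))"
    using max_concurrent_at_length[OF assms] assms(3) by (simp add: max_concurrent_at_Cons_Suc)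
  then have "(LEAST i. ?P i) = Suc (LEAST i. ?P (Suc i))"
    by (rule Least_Suc) simp
  \<comment> \<open>At \<open>i = 0\<close> both sides fail: the left because the head is not
    maximally concurrent, the right by the index range.\<close>
  moreover have "?P (Suc i) \<longleftrightarrow> i \<in> {1..length t} \<and> max_concurrent_at E sim ser inl t i" for i
    using False by (cases i) (auto simp: max_concurrent_at_Cons_Suc)
  ultimately show ?thesis
    using False by (simp add: mc_def)
qed

text \<open>The test at position 1 has the same outcome for both sequences: either both values are
  1, or both are successors of the values of the tails.\<close>

lemma mc_Cons_mono:
  assumes "finite E" and "A \<in> steps E sim" and "(s, t) \<in> gct_cong E sim ser inl"
    and "s \<noteq> []" and "t \<noteq> []" and "mc E sim ser inl s \<le> mc E sim ser inl t"
  shows "mc E sim ser inl (A # s) \<le> mc E sim ser inl (A # t)"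
  using assms max_concurrent_at_1_cong[OF gct_cong_Cons[OF assms(3,2)]]
    gct_cong_step_seqs[OF assms(3)]
  by (simp add: mc_Cons)

text \<open>Proper suffixes of \<open>A # t\<close> are suffixes of \<open>t\<close> and inherit
  their condition from it; only the conditions on the whole sequence remain.\<close>

lemma maximally_concurrent_Cons:
  assumes "A \<in> steps E sim" and "maximally_concurrent E sim ser inl t"
    and "\<And>v. (v, A # t) \<in> gct_cong E sim ser inl \<Longrightarrow> length (A # t) \<le> length v"
    and "\<And>w. (A # t, w) \<in> gct_cong E sim ser inl \<Longrightarrow> length (A # t) = length w \<Longrightarrow>
      mc E sim ser inl (A # t) \<le> mc E sim ser inl w"
  shows "maximally_concurrent E sim ser inl (A # t)"
proof -
  have "mc E sim ser inl (drop (i - 1) (A # t)) \<le> mc E sim ser inl w"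
    if "i \<in> {1..length (A # t)}" and "(drop (i - 1) (A # t), w) \<in> gct_cong E sim ser inl"
      and "length (drop (i - 1) (A # t)) = length w" for i w
  proof (cases "i = 1")
    case True
    with that assms(4) show ?thesis by simp
  next
    case False
    with that(1) obtain j where "i = Suc j" and "j \<in> {1..length t}"
      by (cases i) auto
    moreover from this have "drop (i - 1) (A # t) = drop (j - 1) t"
      by (cases j) auto
    ultimately show ?thesis
      using that assms(2) by (auto simp: maximally_concurrent_def)
  qed
  then show ?thesis
    using assms(1-3) by (auto simp: maximally_concurrent_def)
qed

lemma exists_maximally_concurrent:
  assumes "finite E" and "x \<in> step_seqs E sim"
  shows "\<exists>u. (x, u) \<in> gct_cong E sim ser inl \<and> maximally_concurrent E sim ser inl u"
  using assms(2)
proof (induction "length x" arbitrary: x rule: less_induct)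
  case less
  let ?C = "gct_cong E sim ser inl" and ?mc = "mc E sim ser inl"
  obtain y where y: "(x, y) \<in> ?C" and y_min: "\<And>v. (x, v) \<in> ?C \<Longrightarrow> length y \<le> length v"
    using ex_has_least_nat[of "\<lambda>v. (x, v) \<in> ?C" x length] gct_cong_refl[OF less.prems] by blast
  obtain u where u: "(x, u) \<in> ?C" "length u = length y"
    and u_min: "\<And>v. (x, v) \<in> ?C \<Longrightarrow> length v = length y \<Longrightarrow> ?mc u \<le> ?mc v"
    using ex_has_least_nat[of "\<lambda>v. (x, v) \<in> ?C \<and> length v = length y" y ?mc] y by blast
  show ?case
  proof (cases u)
    case Nil
    with u show ?thesis
      by (auto simp: maximally_concurrent_def)
  next
    case (Cons A t)
    then have A: "A \<in> steps E sim" and t: "t \<in> step_seqs E sim"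
      using gct_cong_step_seqs(2)[OF u(1)] by auto
    \<comment> \<open>Since \<open>x\<close> lies in its own class, the shortest length is at most
      \<open>length x\<close>, and \<open>t\<close> is one step shorter than that.\<close>
    have "length t < length x"
      using y_min[OF gct_cong_refl[OF less.prems]] u(2) Cons by simp
    then obtain s where s: "(t, s) \<in> ?C" "maximally_concurrent E sim ser inl s"
      using less.hyps t by blast
    have xs: "(x, A # s) \<in> ?C"
      using u(1) gct_cong_Cons[OF s(1) A] Cons by (auto intro: gct_cong_trans)
    \<comment> \<open>Minimality of \<open>s\<close> in the class of \<open>t\<close> gives one
      inequality, minimality of \<open>length y\<close> against \<open>A # s\<close> the
      other.\<close>
    have len: "length s = length t"
      using s y_min[OF xs] u(2) Cons by (auto simp: maximally_concurrent_def intro!: antisym)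
    have "?mc (A # s) \<le> ?mc (A # t)"
    proof (cases "t = []")
      case False
      \<comment> \<open>This is condition (2) for \<open>s\<close> at \<open>i = 1\<close>, where
        the suffix is \<open>s\<close> itself, compared with \<open>t\<close>; it applies because
        the lengths agree.\<close>
      have "?mc s \<le> ?mc t"
        using s len False gct_cong_sym[OF s(1)]
        by (auto simp: maximally_concurrent_def Suc_le_eq dest!: bspec[of _ _ 1])
      with False len show ?thesis
        by (intro mc_Cons_mono[OF assms(1) A gct_cong_sym[OF s(1)]]) auto
    qed (use len in simp)
    then have mc_le: "?mc (A # s) \<le> ?mc u"
      using Cons by simp
    have len_eq: "length (A # s) = length y"
      using len u(2) Cons by simp
    have "maximally_concurrent E sim ser inl (A # s)"
    proof (rule maximally_concurrent_Cons[OF A s(2)])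
      show "length (A # s) \<le> length v" if "(v, A # s) \<in> ?C" for v
        using y_min[OF gct_cong_trans[OF xs gct_cong_sym[OF that]]] len_eq by simp
      show "?mc (A # s) \<le> ?mc w" if "(A # s, w) \<in> ?C" and "length (A # s) = length w" for w
        using mc_le u_min[OF gct_cong_trans[OF xs that(1)]] that(2) len_eq by simp
    qed
    with xs show ?thesis by blast
  qed
qed

theorem theorem8p1:
  fixes E :: "'a set" and sim ser inl :: "'a rel" and U :: "'a set list set"
  assumes "g_comtrace_alphabet E sim ser inl"
    and "U \<in> g_comtraces E sim ser inl"
  shows "\<exists>u \<in> U. maximally_concurrent E sim ser inl u"
proof -
  obtain x where "x \<in> step_seqs E sim" and "U = gct_cong E sim ser inl `` {x}"
    using assms(2) unfolding g_comtraces_def by (rule quotientE)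
  with exists_maximally_concurrent[OF g_comtrace_alphabet.finite_E[OF assms(1)]]
  show ?thesis by blast
qed

end
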